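(* Let $\mathbf{B}^i$ be constant $N\times N$ matrices ($N\ge1$), with $i$ running over the spatial coordinates, and suppose that the first-order system $$(\mathbf{1}\,\partial_t+\mathbf{B}^i\partial_i)\phi=0$$ for an $N$-component field $\phi$ is strongly hyperbolic. Then the second-order system obtained by applying the same first-order operator twice, $$(\mathbf{1}\,\partial_t+\mathbf{B}^i\partial_i)(\mathbf{1}\,\partial_t+\mathbf{B}^j\partial_j)\phi=0,$$ is always weakly hyperbolic (in the sense, given in the context, that it has real eigenvalues but is not strongly hyperbolic).
   Context: Repeated indices are summed; there is at least one spatial coordinate; $\mathbf{1}$ is the $N\times N$ identity; matrices are regarded over $\mathbb{C}$; $\|\cdot\|$ is the spectral norm. First-order strong hyperbolicity: the system $(\mathbf{1}\partial_t+\mathbf{B}^i\partial_i)\phi=0$ is strongly hyperbolic if for every unit spatial covector $\hat k_i$ the matrix $\mathbf{B}^i\hat k_i$ has only real eigenvalues and a complete set of eigenvectors, and there is a constant $K$ independent of $\hat k$ such that the matrices $\mathbf{T}_{\hat k}$ having these eigenvectors as columns satisfy $\|\mathbf{T}_{\hat k}\|+\|\mathbf{T}_{\hat k}^{-1}\|\le K$. Second-order systems: for $(\mathbf{A}\partial_t^2+\mathbf{B}_{(2)}^i\partial_i\partial_t+\mathbf{C}^{ij}\partial_i\partial_j)\phi=0$ with constant coefficients and $\mathbf{A}$ invertible, the second-order pencil at a unit covector $\hat k_i$ is $\mathbf{S}(\lambda)=\lambda^2\mathbf{1}+\lambda\mathbf{A}^{-1}\mathbf{B}_{(2)}^i\hat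 k_i+\mathbf{A}^{-1}\mathbf{C}^{ij}\hat k_i\hat k_j$. For the twice-applied operator in the claim this is $\mathbf{S}(\lambda)=(\lambda\mathbf{1}+\mathbf{B}^i\hat k_i)^2$. Eigenvalues of $\mathbf{S}(\lambda)$ are the roots $\sigma$ of $\det\mathbf{S}(\lambda)$; the algebraic multiplicity of $\sigma$ is its multiplicity as a root, and the geometric multiplicity is $\dim\ker\mathbf{S}(\sigma)$. Consider the conditions, for all unit $\hat k_i$: 1. all eigenvalues of $\mathbf{S}(\lambda)$ are real; 2. the algebraic and geometric multiplicities of each eigenvalue are equal; 3. (uniformity) there are constants $c_1,c_2$ independent of $\hat k$ with $\|\mathbf{V}_1\|,\|\mathbf{Q}\|,\|\mathbf{Q}\mathbf{D}_2-\mathbf{D}_1\mathbf{Q}\|\le c_1$ and $\|\mathbf{V}_1^{-1}\|,\|(\mathbf{Q}\mathbf{D}_2-\mathbf{D}_1\mathbf{Q})^{-1}\|\le c_2$, where $\mathbf{D}_1=\mathrm{diag}(\lambda_1,\dots,\lambda_N)$ and $\mathbf{D}_2=\mathrm{diag}(\rho_1,\dots,\rho_N)$ together list the $2N$ eigenvalues of $\mathbf{S}(\lambda)$ with multiplicity, $\mathbf{V}_1$ and $\mathbf{Q}$ are $N\times N$ matrices with $\mathbf{V}_1$ and $\mathbf{Q}\mathbf{D}_2-\mathbf{D}_1\mathbf{Q}$ invertible, and the $i$-th columns of $\mathbf{V}_1$ and of $\mathbf{V}_1\mathbf{Q}$ lie in $\ker\mathbf{S}(\lambda_i)$ and $\ker\mathbf{S}(\rho_i)$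 respectively. The second-order system is strongly hyperbolic if conditions 1, 2 and 3 hold, and is called weakly hyperbolic if condition 1 holds but condition 2 or condition 3 fails. *)

theory Defs
  imports "HOL-Analysis.Analysis"
begin

text \<open>
  Fields have components indexed by \<open>'n\<close>, space has coordinates indexed by \<open>'d\<close>; both index
  types are finite and nonempty. Matrices are complex, which covers real coefficients. Covectors
  \<open>k :: real^'d\<close> are normalised in the Euclidean norm.
\<close>

definition spectral_norm :: "complex^'n^'n \<Rightarrow> real" where
  "spectral_norm M = onorm ((*v) M)"

definition diag :: "('n \<Rightarrow> complex) \<Rightarrow> complex^'n^'n" where
  "diag d = (\<chi> a b. if a = b then d a else 0)"

definition is_eigenvector :: "complex^'n^'n \<Rightarrow> complex \<Rightarrow> complex^'n \<Rightarrow> bool" where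
  "is_eigenvector M \<sigma> v \<longleftrightarrow> v \<noteq> 0 \<and> M *v v = \<sigma> *s v"

definition principal_symbol :: "('d::finite \<Rightarrow> complex^'n^'n) \<Rightarrow> real^'d \<Rightarrow> complex^'n^'n" where
  "principal_symbol B k = (\<Sum>i\<in>UNIV. (k $ i) *\<^sub>R B i)"

text \<open>
  A complete set of eigenvectors, arranged as the columns of \<open>T\<close>; completeness is invertibility
  of \<open>T\<close>.
\<close>

definition eigenvector_matrix :: "complex^'n^'n \<Rightarrow> complex^'n^'n \<Rightarrow> bool" where
  "eigenvector_matrix M T \<longleftrightarrow> invertible T \<and> (\<forall>a. \<exists>\<sigma>. is_eigenvector M \<sigma> (column a T))"

definition first_order_strongly_hyperbolic :: "('d::finite \<Rightarrow> complex^'n^'n) \<Rightarrow> bool" where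
  "first_order_strongly_hyperbolic B \<longleftrightarrow>
    (\<exists>K. \<forall>k. norm k = 1 \<longrightarrow>
      (\<forall>\<sigma> v. is_eigenvector (principal_symbol B k) \<sigma> v \<longrightarrow> \<sigma> \<in> \<real>) \<and>
      (\<exists>T. eigenvector_matrix (principal_symbol B k) T \<and>
           spectral_norm T + spectral_norm (matrix_inv T) \<le> K))"

text \<open>
  The pencil of \<open>A \<partial>\<^sub>t\<^sup>2 + B\<^sup>i \<partial>\<^sub>i \<partial>\<^sub>t + C\<^sup>i\<^sup>j \<partial>\<^sub>i \<partial>\<^sub>j\<close>, as a matrix of polynomials in the spectral
  parameter (coefficients listed from degree 0 upwards), so that its determinant is a polynomial
  whose root multiplicities are given by \<open>order\<close>.
\<close>

definition pencil ::
    "complex^'n^'n \<Rightarrow> ('d::finite \<Rightarrow> complex^'n^'n) \<Rightarrow> ('d \<Rightarrow> 'd \<Rightarrow> complex^'n^'n) \<Rightarrow>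
     real^'d \<Rightarrow> complex poly^'n^'n" where
  "pencil A B C k =
    (\<chi> a b. [: (matrix_inv A ** (\<Sum>i\<in>UNIV. \<Sum>j\<in>UNIV. (k $ i * k $ j) *\<^sub>R C i j)) $ a $ b,
              (matrix_inv A ** (\<Sum>i\<in>UNIV. (k $ i) *\<^sub>R B i)) $ a $ b,
              mat 1 $ a $ b :])"

definition eval_pencil :: "complex poly^'n^'n \<Rightarrow> complex \<Rightarrow> complex^'n^'n" where
  "eval_pencil S \<sigma> = (\<chi> a b. poly (S $ a $ b) \<sigma>)"

definition pencil_eigenvalue :: "complex poly^'n^'n \<Rightarrow> complex \<Rightarrow> bool" where
  "pencil_eigenvalue S \<sigma> \<longleftrightarrow> poly (det S) \<sigma> = 0"

definition pencil_kernel :: "complex poly^'n^'n \<Rightarrow> complex \<Rightarrow> (complex^'n) set" where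
  "pencil_kernel S \<sigma> = {v. eval_pencil S \<sigma> *v v = 0}"

definition algebraic_multiplicity :: "complex poly^'n^'n \<Rightarrow> complex \<Rightarrow> nat" where
  "algebraic_multiplicity S \<sigma> = order \<sigma> (det S)"

text \<open>\<open>vec.dim\<close> is the dimension over the complex scalars; plain \<open>dim\<close> would be the real one.\<close>

definition geometric_multiplicity :: "complex poly^'n^'n \<Rightarrow> complex \<Rightarrow> nat" where
  "geometric_multiplicity S \<sigma> = vec.dim (pencil_kernel S \<sigma>)"

definition real_eigenvalues :: "(real^'d \<Rightarrow> complex poly^'n^'n) \<Rightarrow> bool" where
  "real_eigenvalues S \<longleftrightarrow>
    (\<forall>k. norm k = 1 \<longrightarrow> (\<forall>\<sigma>. pencil_eigenvalue (S k) \<sigma> \<longrightarrow> \<sigma> \<in> \<real>))"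

definition equal_multiplicities :: "(real^'d \<Rightarrow> complex poly^'n^'n) \<Rightarrow> bool" where
  "equal_multiplicities S \<longleftrightarrow>
    (\<forall>k. norm k = 1 \<longrightarrow> (\<forall>\<sigma>. pencil_eigenvalue (S k) \<sigma> \<longrightarrow>
      algebraic_multiplicity (S k) \<sigma> = geometric_multiplicity (S k) \<sigma>))"

text \<open>
  The functions \<open>l\<close> and \<open>r\<close> are the diagonals of \<open>D\<^sub>1\<close> and \<open>D\<^sub>2\<close>; all of \<open>l\<close>, \<open>r\<close>, \<open>V\<close>, \<open>Q\<close> may
  depend on the direction \<open>k\<close>, the two constants may not.
\<close>

definition uniformly_diagonalisable :: "(real^'d \<Rightarrow> complex poly^'n^'n) \<Rightarrow> bool" where
  "uniformly_diagonalisable S \<longleftrightarrow>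
    (\<exists>c1 c2. \<forall>k. norm k = 1 \<longrightarrow>
      (\<exists>l r V Q.
        (\<forall>\<sigma>. card {a. l a = \<sigma>} + card {a. r a = \<sigma>} = algebraic_multiplicity (S k) \<sigma>) \<and>
        invertible V \<and> invertible (Q ** diag r - diag l ** Q) \<and>
        (\<forall>a. column a V \<in> pencil_kernel (S k) (l a)) \<and>
        (\<forall>a. column a (V ** Q) \<in> pencil_kernel (S k) (r a)) \<and>
        spectral_norm V \<le> c1 \<and> spectral_norm Q \<le> c1 \<and>
        spectral_norm (Q ** diag r - diag l ** Q) \<le> c1 \<and>
        spectral_norm (matrix_inv V) \<le> c2 \<and>
        spectral_norm (matrix_inv (Q ** diag r - diag l ** Q)) \<le> c2))"

text \<open>
  Both notions below concern systems with invertible \<open>A\<close>; in particular weak hyperbolicity is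
  not the negation of the strong one.
\<close>

definition second_order_strongly_hyperbolic ::
    "complex^'n^'n \<Rightarrow> ('d::finite \<Rightarrow> complex^'n^'n) \<Rightarrow> ('d \<Rightarrow> 'd \<Rightarrow> complex^'n^'n) \<Rightarrow> bool" where
  "second_order_strongly_hyperbolic A B C \<longleftrightarrow> invertible A \<and>
    real_eigenvalues (pencil A B C) \<and> equal_multiplicities (pencil A B C) \<and>
    uniformly_diagonalisable (pencil A B C)"

definition second_order_weakly_hyperbolic ::
    "complex^'n^'n \<Rightarrow> ('d::finite \<Rightarrow> complex^'n^'n) \<Rightarrow> ('d \<Rightarrow> 'd \<Rightarrow> complex^'n^'n) \<Rightarrow> bool" where
  "second_order_weakly_hyperbolic A B C \<longleftrightarrow> invertible A \<and>
    real_eigenvalues (pencil A B C) \<and>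
    (\<not> equal_multiplicities (pencil A B C) \<or> \<not> uniformly_diagonalisable (pencil A B C))"

text \<open>
  Expanding \<open>(\<partial>\<^sub>t + B\<^sup>i \<partial>\<^sub>i) (\<partial>\<^sub>t + B\<^sup>j \<partial>\<^sub>j)\<close> with constant coefficients gives
  \<open>\<partial>\<^sub>t\<^sup>2 + (B\<^sup>i + B\<^sup>i) \<partial>\<^sub>i \<partial>\<^sub>t + B\<^sup>i B\<^sup>j \<partial>\<^sub>i \<partial>\<^sub>j\<close>, and the pencil becomes a square.
\<close>

definition twice_tt :: "('d \<Rightarrow> complex^'n^'n) \<Rightarrow> complex^'n^'n" where
  "twice_tt B = mat 1"

definition twice_xt :: "('d \<Rightarrow> complex^'n^'n) \<Rightarrow> 'd \<Rightarrow> complex^'n^'n" where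
  "twice_xt B i = B i + B i"

definition twice_xx :: "('d \<Rightarrow> complex^'n^'n) \<Rightarrow> 'd \<Rightarrow> 'd \<Rightarrow> complex^'n^'n" where
  "twice_xx B i j = B i ** B j"

lemma matrix_inv_mat_1: "matrix_inv (mat 1 :: complex^'n^'n) = mat 1"
proof -
  have "\<exists>M. (mat 1 :: complex^'n^'n) ** M = mat 1 \<and> M ** mat 1 = (mat 1 :: complex^'n^'n)"
    by (rule exI[of _ "mat 1"]) simp
  from someI_ex[OF this] show ?thesis by (simp add: matrix_inv_def)
qed

lemma eval_pencil_twice:
  fixes B :: "'d::finite \<Rightarrow> complex^'n^'n"
  shows "eval_pencil (pencil (twice_tt B) (twice_xt B) (twice_xx B) k) \<sigma> =
    (mat \<sigma> + principal_symbol B k) ** (mat \<sigma> + principal_symbol B k)"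
proof -
  let ?P = "principal_symbol B k"
  have C: "(\<Sum>i\<in>UNIV. f i) $ a $ b = (\<Sum>i\<in>UNIV. f i $ a $ b)"
    for f :: "'d \<Rightarrow> complex^'n^'n" and a b
    by (simp add: sum_component)
  have P2: "(\<Sum>i\<in>UNIV. \<Sum>j\<in>UNIV. (k $ i * k $ j) *\<^sub>R (B i ** B j)) = ?P ** ?P"
  proof -
    have "(\<Sum>i\<in>UNIV. \<Sum>j\<in>UNIV. (k $ i * k $ j) *\<^sub>R (B i ** B j)) $ a $ b = (?P ** ?P) $ a $ b"
      for a b
    proof -
      have "(?P ** ?P) $ a $ b = (\<Sum>c\<in>UNIV. \<Sum>i\<in>UNIV. \<Sum>j\<in>UNIV.
          of_real (k $ i * k $ j) * (B i $ a $ c * B j $ c $ b))"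
        by (simp add: principal_symbol_def matrix_matrix_mult_def C sum_product)
          (simp add: scaleR_conv_of_real ac_simps)
      also have "\<dots> = (\<Sum>i\<in>UNIV. \<Sum>c\<in>UNIV. \<Sum>j\<in>UNIV.
          of_real (k $ i * k $ j) * (B i $ a $ c * B j $ c $ b))"
        by (rule sum.swap)
      also have "\<dots> = (\<Sum>i\<in>UNIV. \<Sum>j\<in>UNIV. \<Sum>c\<in>UNIV.
          of_real (k $ i * k $ j) * (B i $ a $ c * B j $ c $ b))"
        by (intro sum.cong refl sum.swap)
      also have "\<dots> = (\<Sum>i\<in>UNIV. \<Sum>j\<in>UNIV. (k $ i * k $ j) *\<^sub>R (B i ** B j)) $ a $ b"
        by (simp add: matrix_matrix_mult_def C sum_distrib_left)
          (simp add: scaleR_conv_of_real sum_distrib_left)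
      finally show ?thesis by simp
    qed
    then show ?thesis by (simp add: vec_eq_iff)
  qed
  have P1: "(\<Sum>i\<in>UNIV. (k $ i) *\<^sub>R (B i + B i)) = ?P + ?P"
    unfolding principal_symbol_def by (simp only: scaleR_add_right sum.distrib)
  have R: "(M ** mat \<sigma>) $ a $ b = \<sigma> * M $ a $ b" "(mat \<sigma> ** M) $ a $ b = \<sigma> * M $ a $ b"
    for M :: "complex^'n^'n" and a b
    by (simp_all add: matrix_matrix_mult_def mat_def if_distrib if_distribR cong: if_cong)
  have LR: "M ** (M' + M'') = M ** M' + M ** M''" "(M' + M'') ** M = M' ** M + M'' ** M"
    for M M' M'' :: "complex^'n^'n"
    by (simp_all add: vec_eq_iff matrix_matrix_mult_def algebra_simps sum.distrib)
  show ?thesis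
    unfolding eval_pencil_def pencil_def twice_tt_def twice_xt_def twice_xx_def P1 P2
    by (simp add: vec_eq_iff matrix_inv_mat_1 LR R)
      (simp add: mat_def algebra_simps)
qed

lemma det_eval_pencil: "det (eval_pencil S \<sigma>) = poly (det S) \<sigma>"
  by (simp add: det_def eval_pencil_def poly_sum poly_prod)

end

theory Submission
  imports Defs
begin

text \<open>
  Fix a unit covector and write \<open>P\<close> for the principal symbol there. Strong hyperbolicity makes \<open>P\<close>
  diagonalisable with real spectrum, and the pencil of the twice applied operator is \<open>(\<lambda> + P)\<^sup>2\<close>.
  Its eigenvalues are therefore the negatives of those of \<open>P\<close>, hence real. In an eigenbasis of \<open>P\<close>
  the pencil is diagonal with entries \<open>(\<lambda> + d\<^sub>a)\<^sup>2\<close>: squaring a diagonal matrix doubles the order of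
  every root of its determinant but leaves its kernel unchanged. So each algebraic multiplicity is
  at least twice the geometric one (\<open>twice_geometric_le_algebraic\<close>). Space has at least one
  unit covector, the pencil there at least one eigenvalue, of positive algebraic multiplicity; so the
  two multiplicities differ there, and the system is not strongly hyperbolic.
\<close>

lemma eigenvector_matrix_diagonalises:
  fixes M T :: "complex^'n^'n"
  assumes "eigenvector_matrix M T"
  obtains d where "\<And>a. is_eigenvector M (d a) (column a T)" "M ** T = T ** diag d"
proof -
  obtain d where d: "\<And>a. is_eigenvector M (d a) (column a T)"
    using assms unfolding eigenvector_matrix_def by metis
  have "(M ** T) $ b $ a = (T ** diag d) $ b $ a" for a b
  proof -
    have "(M ** T) $ b $ a = (M *v column a T) $ b"
      by (simp add: matrix_matrix_mult_def matrix_vector_mult_def column_def)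
    also have "\<dots> = d a * T $ b $ a"
      using d[of a] by (simp add: is_eigenvector_def column_def)
    also have "\<dots> = (T ** diag d) $ b $ a"
      by (simp add: matrix_matrix_mult_def diag_def if_distrib cong: if_cong)
    finally show ?thesis .
  qed
  then have "M ** T = T ** diag d"
    by (simp add: vec_eq_iff)
  with d that show thesis by blast
qed

lemma shift_diagonalised:
  fixes M T :: "complex^'n^'n"
  assumes "M ** T = T ** diag d"
  shows "(mat \<sigma> + M) ** T = T ** diag (\<lambda>a. \<sigma> + d a)"
proof -
  have "(mat \<sigma> ** T) $ a $ b = \<sigma> * T $ a $ b" for a b
    by (simp add: matrix_matrix_mult_def mat_def if_distrib if_distribR cong: if_cong)
  moreover have "(T ** diag f) $ a $ b = f b * T $ a $ b" for f a b
    by (simp add: matrix_matrix_mult_def diag_def if_distrib cong: if_cong)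
  moreover have "(mat \<sigma> + M) ** T = mat \<sigma> ** T + M ** T"
    by (simp add: vec_eq_iff matrix_matrix_mult_def algebra_simps sum.distrib)
  ultimately show ?thesis
    by (simp add: assms vec_eq_iff algebra_simps)
qed

lemma det_diag: "det (diag d :: complex^'n^'n) = (\<Prod>a\<in>UNIV. d a)"
  by (subst det_diagonal) (simp_all add: diag_def)

lemma det_pencil_twice:
  fixes B :: "'d::finite \<Rightarrow> complex^'n^'n" and T :: "complex^'n^'n"
  assumes "invertible T" and PT: "principal_symbol B k ** T = T ** diag d"
  shows "det (pencil (twice_tt B) (twice_xt B) (twice_xx B) k) = (\<Prod>a\<in>UNIV. [:d a, 1:])\<^sup>2"
proof -
  have T: "det T \<noteq> 0"
    using assms(1) invertible_det_nz by blast
  have "det (mat \<sigma> + principal_symbol B k) = (\<Prod>a\<in>UNIV. \<sigma> + d a)" for \<sigma>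
    using arg_cong[OF shift_diagonalised[OF PT, of \<sigma>], of det] T
    by (simp add: det_mul det_diag)
  then show ?thesis
    by (intro poly_ext)
      (simp add: det_eval_pencil[symmetric] eval_pencil_twice det_mul poly_prod power2_eq_square
        add.commute)
qed

text \<open>
  A diagonal matrix and its square have the same kernel, so the kernel is no larger than the
  eigenspace of the principal symbol.
\<close>

lemma pencil_kernel_twice_subset:
  fixes B :: "'d::finite \<Rightarrow> complex^'n^'n" and T :: "complex^'n^'n"
  assumes "invertible T" and PT: "principal_symbol B k ** T = T ** diag d"
  shows "pencil_kernel (pencil (twice_tt B) (twice_xt B) (twice_xx B) k) \<sigma>
    \<subseteq> vec.span ((\<lambda>a. column a T) ` {a. \<sigma> + d a = 0})"
proof
  fix v
  let ?M = "mat \<sigma> + principal_symbol B k" and ?D = "diag (\<lambda>a. \<sigma> + d a) :: complex^'n^'n"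
  assume "v \<in> pencil_kernel (pencil (twice_tt B) (twice_xt B) (twice_xx B) k) \<sigma>"
  then have v: "(?M ** ?M) *v v = 0"
    by (simp add: pencil_kernel_def eval_pencil_twice)
  obtain T' where T': "T ** T' = mat 1" "T' ** T = mat 1"
    using assms(1) unfolding invertible_def by blast
  define w where "w = T' *v v"
  have vw: "v = T *v w"
    by (simp add: w_def matrix_vector_mul_assoc T')
  have "?M ** ?M ** T = T ** (?D ** ?D)"
    using shift_diagonalised[OF PT, of \<sigma>] by (metis matrix_mul_assoc)
  then have "T *v ((?D ** ?D) *v w) = 0"
    using v by (simp add: vw matrix_vector_mul_assoc)
  then have "T' *v (T *v ((?D ** ?D) *v w)) = 0"
    by simp
  then have "?D *v (?D *v w) = 0"
    by (simp add: matrix_vector_mul_assoc matrix_mul_assoc T')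
  moreover have "(?D *v u) $ a = (\<sigma> + d a) * u $ a" for u a
    by (simp add: matrix_vector_mult_def diag_def if_distrib if_distribR cong: if_cong)
  ultimately have w0: "w $ a = 0" if "\<sigma> + d a \<noteq> 0" for a
    using that by (metis mult_eq_0_iff zero_index)
  have "v = (\<Sum>a\<in>UNIV. w $ a *s column a T)"
    by (simp add: vw matrix_mult_sum)
  also have "\<dots> \<in> vec.span ((\<lambda>a. column a T) ` {a. \<sigma> + d a = 0})"
  proof (intro vec.span_sum)
    fix a
    show "w $ a *s column a T \<in> vec.span ((\<lambda>a. column a T) ` {a. \<sigma> + d a = 0})"
      by (cases "\<sigma> + d a = 0") (simp_all add: w0 vec.span_zero vec.span_scale vec.span_base)
  qed
  finally show "v \<in> vec.span ((\<lambda>a. column a T) ` {a. \<sigma> + d a = 0})" .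
qed

text \<open>
  With \<open>m\<close> entries of the diagonal form equal to \<open>-\<sigma>\<close>, the determinant is divisible by the
  \<open>2m\<close>-th power of the linear factor at \<open>\<sigma>\<close>, while \<open>m\<close> eigenvectors span the kernel.
\<close>

lemma twice_geometric_le_algebraic:
  fixes B :: "'d::finite \<Rightarrow> complex^'n^'n" and T :: "complex^'n^'n"
  assumes "invertible T" and PT: "principal_symbol B k ** T = T ** diag d"
  defines "S \<equiv> pencil (twice_tt B) (twice_xt B) (twice_xx B) k"
  shows "2 * geometric_multiplicity S \<sigma> \<le> algebraic_multiplicity S \<sigma>"
proof -
  let ?Z = "{a. \<sigma> + d a = 0}"
  have detS: "det S = (\<Prod>a\<in>UNIV. [:d a, 1:])\<^sup>2"
    unfolding S_def by (rule det_pencil_twice[OF assms(1,2)])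
  have "geometric_multiplicity S \<sigma> \<le> card ((\<lambda>a. column a T) ` ?Z)"
    unfolding geometric_multiplicity_def S_def
    by (intro vec.dim_le_card pencil_kernel_twice_subset assms(1,2)) simp
  also have "\<dots> \<le> card ?Z"
    by (rule card_image_le) simp
  finally have geo: "geometric_multiplicity S \<sigma> \<le> card ?Z" .
  have "(\<Prod>a\<in>?Z. [:d a, 1:]) = (\<Prod>a\<in>?Z. [:- \<sigma>, 1:])"
    by (intro prod.cong) (auto simp: add_eq_0_iff)
  then have "(\<Prod>a\<in>?Z. [:d a, 1:]) = [:- \<sigma>, 1:] ^ card ?Z"
    by simp
  then have "[:- \<sigma>, 1:] ^ card ?Z dvd (\<Prod>a\<in>UNIV. [:d a, 1:])"
    using prod_dvd_prod_subset[of UNIV ?Z "\<lambda>a. [:d a, 1:]"] by simp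
  then have "[:- \<sigma>, 1:] ^ (2 * card ?Z) dvd det S"
    unfolding detS by (subst mult.commute, subst power_mult) (rule dvd_power_same)
  moreover have "det S \<noteq> 0"
    by (simp add: detS)
  ultimately have "2 * card ?Z \<le> algebraic_multiplicity S \<sigma>"
    by (simp add: algebraic_multiplicity_def order_divides)
  with geo show ?thesis by linarith
qed

theorem theorem4:
  fixes B :: "'d::finite \<Rightarrow> complex^'n^'n"
  assumes "first_order_strongly_hyperbolic B"
  shows "second_order_weakly_hyperbolic (twice_tt B) (twice_xt B) (twice_xx B)"
proof -
  let ?S = "pencil (twice_tt B) (twice_xt B) (twice_xx B)"
  have real: "\<sigma> \<in> \<real>"
    if "norm k = 1" "is_eigenvector (principal_symbol B k) \<sigma> v" for k \<sigma> v
    using assms that unfolding first_order_strongly_hyperbolic_def by blast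
  have diagonal: "\<exists>(T :: complex^'n^'n) d. invertible T \<and>
      (\<forall>a. is_eigenvector (principal_symbol B k) (d a) (column a T)) \<and>
      principal_symbol B k ** T = T ** diag d" if k: "norm k = 1" for k
  proof -
    obtain T where T: "eigenvector_matrix (principal_symbol B k) T"
      using assms k unfolding first_order_strongly_hyperbolic_def by blast
    then obtain d where "\<And>a. is_eigenvector (principal_symbol B k) (d a) (column a T)"
      "principal_symbol B k ** T = T ** diag d"
      using eigenvector_matrix_diagonalises by blast
    with T show ?thesis
      unfolding eigenvector_matrix_def by blast
  qed
  have "real_eigenvalues ?S"
    unfolding real_eigenvalues_def
  proof (intro allI impI)
    fix k :: "real^'d" and \<sigma>
    assume k: "norm k = 1" and \<sigma>: "pencil_eigenvalue (?S k) \<sigma>"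
    obtain T :: "complex^'n^'n" and d
      where T: "invertible T" "principal_symbol B k ** T = T ** diag d"
      and ev: "\<And>a. is_eigenvector (principal_symbol B k) (d a) (column a T)"
      using diagonal[OF k] by blast
    obtain a where "d a + \<sigma> = 0"
      using \<sigma> by (auto simp: pencil_eigenvalue_def det_pencil_twice[OF T] poly_prod)
    then have "\<sigma> = - d a"
      by (simp add: add_eq_0_iff)
    then show "\<sigma> \<in> \<real>"
      using real[OF k ev] by simp
  qed
  moreover have "\<not> equal_multiplicities ?S"
  proof
    assume eq: "equal_multiplicities ?S"
    define k :: "real^'d" where "k = axis undefined 1"
    have k: "norm k = 1"
      by (simp add: k_def)
    obtain T :: "complex^'n^'n" and d
      where T: "invertible T" "principal_symbol B k ** T = T ** diag d"
      using diagonal[OF k] by blast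
    \<comment> \<open>The negative of any eigenvalue of the principal symbol will do.\<close>
    define \<sigma> where "\<sigma> = - d undefined"
    have root: "poly (det (?S k)) \<sigma> = 0"
      by (auto simp: det_pencil_twice[OF T] poly_prod \<sigma>_def)
    have "det (?S k) \<noteq> 0"
      by (simp add: det_pencil_twice[OF T])
    with root have "algebraic_multiplicity (?S k) \<sigma> > 0"
      by (simp add: algebraic_multiplicity_def order_root)
    moreover have "algebraic_multiplicity (?S k) \<sigma> = geometric_multiplicity (?S k) \<sigma>"
      using eq k root unfolding equal_multiplicities_def pencil_eigenvalue_def by blast
    ultimately show False
      using twice_geometric_le_algebraic[OF T, of \<sigma>] by linarith
  qed
  moreover have "invertible (twice_tt B)"
    by (auto simp: twice_tt_def invertible_def intro!: exI[of _ "mat 1"])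
  ultimately show ?thesis
    unfolding second_order_weakly_hyperbolic_def by blast
qed

end
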